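(* Let $m$ and $n$ be two even positive integers with $m\leq n$, and let $p$ be a positive integer. A magic column rectangle $MCR(m^{(1)},n^{(1)};p)$ exists if and only if both of the following hold: (i) $m+n\equiv 0 \pmod 4$; and (ii) $1=2(2pn+1)^2-(2pm+2pn+1)^2$ or $m\geq (\sqrt{2}-1)n+\frac{\sqrt{2}-1}{2p}$.
   Context: A magic column rectangle $MCR(m^{(1)},n^{(1)};p)$ (with $m\le n$) is an $(m+n)\times p$ matrix whose entries are $1,2,\ldots,(m+n)p$, each appearing exactly once, which is partitioned into two blocks, the first consisting of $m$ rows (an $m\times p$ submatrix) and the second of the remaining $n$ rows (an $n\times p$ submatrix), such that the sum of the entries in every column of each block is the same constant (necessarily $\frac{(m+n)(mp+np+1)}{4}$). *)

theory Defs
  imports Complex_Main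
begin

definition is_MCR :: "nat \<Rightarrow> nat \<Rightarrow> nat \<Rightarrow> (nat \<Rightarrow> nat \<Rightarrow> nat) \<Rightarrow> bool" where
  "is_MCR m n p A \<longleftrightarrow>
     bij_betw (\<lambda>(i, j). A i j) ({0..<m+n} \<times> {0..<p}) {1..(m+n)*p} \<and>
     (\<exists>c. \<forall>j<p. (\<Sum>i<m. A i j) = c \<and> (\<Sum>i\<in>{m..<m+n}. A i j) = c)"

definition MCR_exists :: "nat \<Rightarrow> nat \<Rightarrow> nat \<Rightarrow> bool" where
  "MCR_exists m n p \<longleftrightarrow> (\<exists>A. is_MCR m n p A)"

end

theory Submission
  imports Defs
begin

text \<open>
  Let $N = (m + n) p$. Double counting gives $4 c = (m + n)(N + 1)$ with $N + 1$ odd, and the $np$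
  distinct entries of the second block sum to at least $np(np + 1)/2$; clearing denominators, this
  bound is condition (ii), whose first alternative is the case of equality.

  Conversely, cut $1, \ldots, N$ into $m + n$ intervals of length $p$ and use each as a row,
  alternately increasing and decreasing. Then all columns are constant within each block, and the
  choice of the intervals given to the first block changes its column sum in steps of $p$. To raise
  that sum by a further $r < p$, take consecutive intervals $k$ in the first block and $k + 1$ in
  the second and shift the row $k$ up by $r$. The first $r$ entries of the row $k + 1$ are then
  lowered by $p$, and rotating one further row of the second block by $r$ makes the column sums
  constant again. The bound says exactly that the required sum does not exceed the one obtained
  when the first block has all the largest entries.
\<close>

section \<open>Necessity\<close>

definition second_block_bound :: "nat \<Rightarrow> nat \<Rightarrow> nat \<Rightarrow> bool" where
  "second_block_bound m n p \<longleftrightarrow> 2 * n * (n * p + 1) \<le> (m + n) * ((m + n) * p + 1)"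

lemma inj_on_pos_sum_ge:
  fixes f :: "'a \<Rightarrow> nat"
  assumes "finite I" and "inj_on f I" and pos: "\<And>i. i \<in> I \<Longrightarrow> 0 < f i"
  shows "card I * (card I + 1) \<le> 2 * sum f I"
proof -
  have "0 \<notin> f ` I" using pos by fastforce
  then have "card (insert 0 (f ` I)) = Suc (card I)"
    using assms by (simp add: card_image)
  then have "\<Sum>{0..card I} \<le> \<Sum>(insert 0 (f ` I))"
    by (metis card_sum_le_nat_sum atLeastLessThanSuc_atLeastAtMost)
  also have "\<dots> = sum f I"
    using assms \<open>0 \<notin> f ` I\<close> by (simp add: sum.reindex)
  finally show ?thesis using double_gauss_sum[of "card I", where ?'a = nat] by simp
qed

lemma constant_column_sum:
  fixes A :: "nat \<Rightarrow> nat \<Rightarrow> nat"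
  assumes bij: "bij_betw (\<lambda>(i, j). A i j) ({0..<M} \<times> {0..<p}) {1..M * p}"
    and "0 < p" and columns: "\<And>j. j < p \<Longrightarrow> (\<Sum>i<M. A i j) = s"
  shows "2 * s = M * (M * p + 1)"
proof -
  have "p * s = (\<Sum>j<p. \<Sum>i<M. A i j)" using columns by simp
  also have "\<dots> = (\<Sum>i<M. \<Sum>j<p. A i j)" by (rule sum.swap)
  also have "\<dots> = \<Sum>{1..M * p}"
    using sum.reindex_bij_betw[OF bij, of "\<lambda>x. x"]
    by (simp add: case_prod_unfold sum.cartesian_product atLeast0LessThan)
  finally have "p * (2 * s) = p * (M * (M * p + 1))"
    using double_gauss_sum_from_Suc_0[of "M * p", where ?'a = nat] by (simp add: algebra_simps)
  then show ?thesis using \<open>0 < p\<close> by simp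
qed

lemma sum_lessThan_add:
  fixes f :: "nat \<Rightarrow> 'a :: comm_monoid_add"
  shows "(\<Sum>i<m + n. f i) = (\<Sum>i<m. f i) + (\<Sum>i\<in>{m..<m + n}. f i)"
  using sum.atLeastLessThan_concat[of 0 m "m + n" f] by (simp add: atLeast0LessThan)

lemma is_MCR_column_sum:
  assumes "is_MCR m n p A" and "0 < p"
  obtains c where "\<And>j. j < p \<Longrightarrow> (\<Sum>i\<in>{m..<m + n}. A i j) = c"
    and "4 * c = (m + n) * ((m + n) * p + 1)"
proof -
  obtain c where first: "\<And>j. j < p \<Longrightarrow> (\<Sum>i<m. A i j) = c"
    and second: "\<And>j. j < p \<Longrightarrow> (\<Sum>i\<in>{m..<m + n}. A i j) = c"
    using assms(1) unfolding is_MCR_def by blast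
  have "2 * (2 * c) = (m + n) * ((m + n) * p + 1)"
    using assms first second unfolding is_MCR_def
    by (intro constant_column_sum[of A]) (auto simp: sum_lessThan_add)
  then show thesis using second that by simp
qed

lemma is_MCR_mod_4_eq_0:
  assumes "is_MCR m n p A" and "0 < p" and "even (m + n)"
  shows "(m + n) mod 4 = 0"
proof -
  obtain c where "4 * c = (m + n) * ((m + n) * p + 1)"
    using is_MCR_column_sum[OF assms(1,2)] .
  then have "4 dvd (m + n) * ((m + n) * p + 1)" by (metis dvd_triv_left)
  moreover have "coprime (2 ^ 2) ((m + n) * p + 1)"
    using assms(3) by (simp only: coprime_power_left_iff coprime_left_2_iff_odd) simp
  ultimately have "4 dvd m + n"
    using coprime_dvd_mult_left_iff[of 4 "(m + n) * p + 1" "m + n"] by simp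
  then show ?thesis by simp
qed

lemma is_MCR_second_block_bound:
  assumes "is_MCR m n p A" and "0 < p"
  shows "second_block_bound m n p"
proof -
  obtain c where second: "\<And>j. j < p \<Longrightarrow> (\<Sum>i\<in>{m..<m + n}. A i j) = c"
    and magic: "4 * c = (m + n) * ((m + n) * p + 1)"
    using is_MCR_column_sum[OF assms] by blast
  let ?B = "{m..<m + n} \<times> {0..<p}"
  have bij: "bij_betw (\<lambda>(i, j). A i j) ({0..<m + n} \<times> {0..<p}) {1..(m + n) * p}"
    using assms(1) by (simp add: is_MCR_def)
  have "inj_on (\<lambda>(i, j). A i j) ?B"
    using bij by (rule inj_on_subset[OF bij_betw_imp_inj_on]) auto
  moreover have "0 < A i j" if "(i, j) \<in> ?B" for i j
    using bij_betw_apply[OF bij, of "(i, j)"] that by auto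
  ultimately have "(n * p) * (n * p + 1) \<le> 2 * (\<Sum>(i, j)\<in>?B. A i j)"
    using inj_on_pos_sum_ge[of ?B "\<lambda>(i, j). A i j"] by auto
  also have "(\<Sum>(i, j)\<in>?B. A i j) = (\<Sum>j<p. \<Sum>i\<in>{m..<m + n}. A i j)"
    by (subst sum.swap) (simp add: sum.cartesian_product atLeast0LessThan)
  also have "\<dots> = p * c" using second by simp
  finally have "p * (2 * n * (n * p + 1)) \<le> p * (4 * c)" by (simp add: algebra_simps)
  then show ?thesis using magic \<open>0 < p\<close> by (simp add: second_block_bound_def)
qed

section \<open>Distributing the intervals over the rows\<close>

definition swap_blocks :: "nat \<Rightarrow> nat \<Rightarrow> nat \<Rightarrow> nat \<Rightarrow> nat" where
  "swap_blocks a b c x =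
     (if a \<le> x \<and> x < a + b then x + c else if a + b \<le> x \<and> x < a + b + c then x - b else x)"

lemma
  shows swap_blocks_below: "x < a \<Longrightarrow> swap_blocks a b c x = x"
    and swap_blocks_left: "a \<le> x \<Longrightarrow> x < a + b \<Longrightarrow> swap_blocks a b c x = x + c"
    and swap_blocks_right: "a + b \<le> x \<Longrightarrow> x < a + b + c \<Longrightarrow> swap_blocks a b c x = x - b"
    and swap_blocks_above: "a + b + c \<le> x \<Longrightarrow> swap_blocks a b c x = x"
    and swap_blocks_0: "swap_blocks a b 0 x = x"
  by (simp_all add: swap_blocks_def)

lemmas swap_blocks_simps =
  swap_blocks_below swap_blocks_left swap_blocks_right swap_blocks_above swap_blocks_0

lemma bij_betw_swap_blocks:
  assumes "a + b + c \<le> N"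
  shows "bij_betw (swap_blocks a b c) {..<N} {..<N}"
  using assms
  by (intro bij_betw_byWitness[where f' = "swap_blocks a c b"]) (auto simp: swap_blocks_def)

text \<open>
  From the inside out: the second block is rotated by \<open>s\<close>, the last \<open>q\<close> rows of the first block
  move past the second block, and the row before them moves up by \<open>s\<close>, to just below the row that
  now opens the second block.
\<close>
definition interval_of_row :: "nat \<Rightarrow> nat \<Rightarrow> nat \<Rightarrow> nat \<Rightarrow> nat \<Rightarrow> nat" where
  "interval_of_row m n q s =
     swap_blocks (m - Suc q) 1 s \<circ> swap_blocks (m - q) q n \<circ> swap_blocks m (n - s) s"

context
  fixes m n q s :: nat
  assumes lifted: "q < m \<and> s < n \<or> q = m \<and> s = 0"
begin

lemma bij_betw_interval_of_row:
  assumes "0 < m"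
  shows "bij_betw (interval_of_row m n q s) {..<m + n} {..<m + n}"
  unfolding interval_of_row_def
  by (intro bij_betw_trans[of _ "{..<m + n}" "{..<m + n}"] bij_betw_swap_blocks)
    (use assms lifted in auto)

lemma interval_of_row_first_block:
  assumes "i < m"
  shows "interval_of_row m n q s i =
    i + (if i \<in> {m - q..<m} then n else 0) + (if Suc (i + q) = m then s else 0)"
proof -
  consider "Suc (i + q) < m" | "Suc (i + q) = m" | "m \<le> i + q" by linarith
  then show ?thesis
    using assms lifted by cases (auto simp: interval_of_row_def swap_blocks_simps)
qed

lemma sum_interval_of_row: "(\<Sum>i<m. interval_of_row m n q s i) = \<Sum>{..<m} + (n * q + s)"
proof -
  have "(\<Sum>i<m. if i \<in> {m - q..<m} then n else 0) = (\<Sum>i\<in>{..<m} \<inter> {m - q..<m}. n)"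
    by (simp only: sum.inter_restrict finite_lessThan)
  also have "{..<m} \<inter> {m - q..<m} = {m - q..<m}" by auto
  finally have "(\<Sum>i<m. if i \<in> {m - q..<m} then n else 0) = n * q"
    using lifted by auto
  moreover have "(\<Sum>i<m. if Suc (i + q) = m then s else 0) = s"
  proof (cases "q < m")
    case True
    then have "Suc (i + q) = m \<longleftrightarrow> i = m - Suc q" for i by auto
    then show ?thesis using True by simp
  qed (use lifted in simp)
  ultimately show ?thesis
    by (simp add: interval_of_row_first_block sum.distrib del: atLeastLessThan_iff)
qed

end

lemma interval_of_row_adjacent:
  assumes "q < m" and "s < n"
  shows "interval_of_row m n q s m = Suc (interval_of_row m n q s (m - Suc q))"
  using assms by (simp add: interval_of_row_def swap_blocks_simps)

lemma exists_interval_arrangement: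
  assumes "t \<le> m * n" and "0 < m" and "0 < n"
  obtains \<pi> h where "bij_betw \<pi> {..<m + n} {..<m + n}" and "(\<Sum>i<m. \<pi> i) = \<Sum>{..<m} + t"
    and "h < m" and "t < m * n \<Longrightarrow> \<pi> m = Suc (\<pi> h)"
proof -
  define q s where "q = t div n" and "s = t mod n"
  have t_eq: "n * q + s = t" by (simp add: q_def s_def)
  have row_range: "q < m \<and> s < n" if "t < m * n"
    using that \<open>0 < n\<close> by (simp add: q_def s_def less_mult_imp_div_less)
  have "q < m \<and> s < n \<or> q = m \<and> s = 0"
  proof (cases "t < m * n")
    case False
    then have "t = m * n" using assms(1) by simp
    then show ?thesis using \<open>0 < n\<close> by (simp add: q_def s_def)
  qed (use row_range in simp)
  note bij_betw_interval_of_row[OF this \<open>0 < m\<close>] sum_interval_of_row[OF this]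
  then show thesis
    using that[of "interval_of_row m n q s" "m - Suc q"]
      row_range interval_of_row_adjacent t_eq \<open>0 < m\<close>
    by auto
qed

section \<open>Filling the rows\<close>

lemma bij_betw_mult_add:
  fixes M p :: nat
  shows "bij_betw (\<lambda>(q, v). p * q + v) ({..<M} \<times> {..<p}) {..<M * p}"
proof (rule bij_betw_byWitness[where f' = "\<lambda>x. (x div p, x mod p)"])
  have "p * q + v < M * p" if "q < M" "v < p" for q v
    using mult_le_mono2[of "Suc q" M p] that by (simp add: algebra_simps)
  then show "(\<lambda>(q, v). p * q + v) ` ({..<M} \<times> {..<p}) \<subseteq> {..<M * p}" by auto
qed (auto simp: less_mult_imp_div_less intro!: mod_less_divisor intro: gr0I)

lemma bij_betw_Times_fibres:
  assumes "bij_betw f A B" and "\<And>x. x \<in> A \<Longrightarrow> bij_betw (g x) C D"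
  shows "bij_betw (\<lambda>(x, y). (f x, g x y)) (A \<times> C) (B \<times> D)"
  using assms unfolding bij_betw_def inj_on_def by (auto simp: image_iff) blast+

lemma swap_blocks_interval:
  assumes "v < p" and "r < p"
  shows "swap_blocks (p * k) p r (p * q + v) + (if q = Suc k \<and> v < r then p else 0)
    = p * q + v + (if q = k then r else 0)"
proof -
  consider "q = k" | "q = Suc k" | (below) "Suc q \<le> k" | (beyond) "Suc (Suc k) \<le> q"
    by linarith
  then show ?thesis
  proof cases
    case below
    from mult_le_mono2[OF this, of p] show ?thesis
      using below assms by (simp add: swap_blocks_simps)
  next
    case beyond
    from mult_le_mono2[OF this, of p] show ?thesis
      using beyond assms by (simp add: swap_blocks_simps)
  qed (use assms in \<open>auto simp: swap_blocks_def\<close>)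
qed

definition snake :: "nat \<Rightarrow> nat \<Rightarrow> nat \<Rightarrow> nat" where
  "snake p i j = (if even i then j else p - Suc j)"

lemma bij_betw_snake: "bij_betw (snake p i) {..<p} {..<p}"
  by (intro bij_betw_byWitness[where f' = "snake p i"]) (auto simp: snake_def)

lemma sum_Suc_snake:
  assumes "even l" and "even n" and "j < p"
  shows "(\<Sum>i\<in>{l..<l + n}. Suc (snake p i j)) = n div 2 * (p + 1)"
proof -
  have "(\<Sum>i\<in>{l..<l + 2 * a}. Suc (snake p i j)) = a * (p + 1)" for a
    using assms by (induction a) (simp_all add: snake_def)
  then show ?thesis using \<open>even n\<close> by (metis dvd_mult_div_cancel)
qed

text \<open>
  Row \<open>i\<close> is filled from the interval \<open>\<pi> i\<close>. The interval of the row \<open>h\<close> is shifted up by \<open>r\<close> and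
  the row \<open>m + 2\<close> is rotated by \<open>r\<close>; that \<open>m\<close> and \<open>m + 2\<close> are even makes both of these rows of the
  second block increasing before they are changed.
\<close>
locale shifted_interval_rows =
  fixes m n p r h :: nat and \<pi> :: "nat \<Rightarrow> nat"
  assumes even_m: "even m" and even_n: "even n" and h_less: "h < m" and r_less: "r < p"
    and bij_rows: "bij_betw \<pi> {..<m + n} {..<m + n}"
    and adjacent: "0 < r \<Longrightarrow> 2 < n \<and> \<pi> m = Suc (\<pi> h)"
begin

definition offset :: "nat \<Rightarrow> nat \<Rightarrow> nat" where
  "offset i = (if i = m + 2 then swap_blocks 0 r (p - r) else snake p i)"

definition entry :: "nat \<Rightarrow> nat \<Rightarrow> nat" where
  "entry i j = Suc (swap_blocks (p * \<pi> h) p r (p * \<pi> i + offset i j))"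

lemma bij_betw_offset: "bij_betw (offset i) {..<p} {..<p}"
  using r_less by (simp add: offset_def bij_betw_swap_blocks bij_betw_snake)

lemma offset_less: "j < p \<Longrightarrow> offset i j < p"
  using bij_betw_apply[OF bij_betw_offset, of j i] by simp

lemma offset_eq_snake:
  assumes "j < p"
  shows "offset i j + (if i = m + 2 then r else 0)
    = snake p i j + (if i = m + 2 \<and> j < r then p else 0)"
  using assms even_m r_less by (auto simp: offset_def snake_def swap_blocks_def)

lemma rows_less: "i < m + n \<Longrightarrow> \<pi> i < m + n"
  using bij_betw_apply[OF bij_rows, of i] by simp

lemma rows_eq_iff: "i < m + n \<Longrightarrow> i' < m + n \<Longrightarrow> \<pi> i = \<pi> i' \<longleftrightarrow> i = i'"
  using bij_rows by (auto simp: bij_betw_def inj_on_eq_iff)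

lemma bij_betw_entry:
  "bij_betw (\<lambda>(i, j). entry i j) ({0..<m + n} \<times> {0..<p}) {1..(m + n) * p}"
proof -
  let ?N = "(m + n) * p"
  let ?swap = "swap_blocks (p * \<pi> h) p r" and ?unswapped = "\<lambda>(i, j). p * \<pi> i + offset i j"
  have "bij_betw ((\<lambda>(q, v). p * q + v) \<circ> (\<lambda>(i, j). (\<pi> i, offset i j)))
      ({..<m + n} \<times> {..<p}) {..<?N}"
    by (intro bij_betw_trans[OF bij_betw_Times_fibres bij_betw_mult_add] bij_rows bij_betw_offset)
  then have "bij_betw ?unswapped ({..<m + n} \<times> {..<p}) {..<?N}"
    by (simp add: comp_def case_prod_unfold)
  moreover have "bij_betw ?swap {..<?N} {..<?N}"
  proof (rule bij_betw_swap_blocks)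
    have "p * (\<pi> h + (if r = 0 then 1 else 2)) \<le> p * (m + n)"
      using rows_less[of h] rows_less[of m] h_less adjacent by (intro mult_le_mono2) auto
    then show "p * \<pi> h + p + r \<le> ?N"
      using r_less by (auto simp: algebra_simps split: if_splits)
  qed
  moreover have "bij_betw Suc {..<?N} {1..?N}"
    by (simp add: bij_betw_def image_Suc_lessThan)
  ultimately have "bij_betw (Suc \<circ> (?swap \<circ> ?unswapped)) ({..<m + n} \<times> {..<p}) {1..?N}"
    by (blast intro: bij_betw_trans)
  then show ?thesis by (simp add: comp_def case_prod_unfold entry_def atLeast0LessThan)
qed

lemma entry_eq:
  assumes "i < m + n" and "j < p"
  shows "entry i j + (if i = m \<and> j < r then p else 0)
    = p * \<pi> i + Suc (offset i j) + (if i = h then r else 0)"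
proof -
  have "\<pi> i = Suc (\<pi> h) \<and> offset i j < r \<longleftrightarrow> i = m \<and> j < r"
  proof (cases "r = 0")
    case False
    then have "\<pi> i = Suc (\<pi> h) \<longleftrightarrow> i = m" using assms(1) adjacent rows_eq_iff[of i m] by auto
    moreover have "offset m j = j" using even_m by (simp add: offset_def snake_def)
    ultimately show ?thesis by auto
  qed simp
  moreover have "\<pi> i = \<pi> h \<longleftrightarrow> i = h" using assms(1) h_less by (simp add: rows_eq_iff)
  ultimately show ?thesis
    using swap_blocks_interval[OF offset_less[OF assms(2)] r_less, of "\<pi> h" "\<pi> i" i]
    by (simp add: entry_def)
qed

lemma sum_first_block:
  assumes "j < p"
  shows "(\<Sum>i<m. entry i j) = p * (\<Sum>i<m. \<pi> i) + m div 2 * (p + 1) + r"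
proof -
  have "entry i j = p * \<pi> i + Suc (snake p i j) + (if i = h then r else 0)" if "i < m" for i
    using entry_eq[of i j] that assms by (simp add: offset_def)
  then have "(\<Sum>i<m. entry i j) =
      (\<Sum>i<m. p * \<pi> i + Suc (snake p i j) + (if i = h then r else 0))"
    by simp
  also have "\<dots> = p * (\<Sum>i<m. \<pi> i) + (\<Sum>i<m. Suc (snake p i j)) + r"
    using h_less by (simp only: sum.distrib) (simp add: sum_distrib_left)
  also have "(\<Sum>i<m. Suc (snake p i j)) = m div 2 * (p + 1)"
    using sum_Suc_snake[of 0 m j p] even_m assms by (simp add: atLeast0LessThan)
  finally show ?thesis .
qed

lemma sum_second_block:
  assumes "j < p"
  shows "(\<Sum>i\<in>{m..<m + n}. entry i j) + r
    = p * (\<Sum>i\<in>{m..<m + n}. \<pi> i) + n div 2 * (p + 1)"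
proof -
  let ?I = "{m..<m + n}"
  let ?lowered = "\<lambda>i. if i = m \<and> j < r then p else 0"
  let ?rotated = "\<lambda>i. if i = m + 2 then r else 0"
  let ?wrapped = "\<lambda>i. if i = m + 2 \<and> j < r then p else 0"
  have "entry i j + ?lowered i + ?rotated i = p * \<pi> i + Suc (snake p i j) + ?wrapped i"
    if "i \<in> ?I" for i
    using entry_eq[of i j] offset_eq_snake[OF assms, of i] that assms h_less by simp
  then have "(\<Sum>i\<in>?I. entry i j + ?lowered i + ?rotated i) =
      (\<Sum>i\<in>?I. p * \<pi> i + Suc (snake p i j) + ?wrapped i)"
    by (rule sum.cong[OF refl])
  then have "(\<Sum>i\<in>?I. entry i j) + sum ?lowered ?I + sum ?rotated ?I =
      p * (\<Sum>i\<in>?I. \<pi> i) + n div 2 * (p + 1) + sum ?wrapped ?I"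
    using sum_Suc_snake[OF even_m even_n assms] by (simp only: sum.distrib sum_distrib_left)
  moreover have "sum ?rotated ?I = r"
    using adjacent by (cases "r = 0") auto
  moreover have "sum ?lowered ?I = sum ?wrapped ?I"
    using adjacent by (cases "j < r") auto
  ultimately show ?thesis by simp
qed

end

lemma is_MCR_if_constant_blocks:
  assumes bij: "bij_betw (\<lambda>(i, j). A i j) ({0..<m + n} \<times> {0..<p}) {1..(m + n) * p}"
    and "0 < p"
    and first: "\<And>j. j < p \<Longrightarrow> (\<Sum>i<m. A i j) = c"
    and second: "\<And>j. j < p \<Longrightarrow> (\<Sum>i\<in>{m..<m + n}. A i j) = d"
    and magic: "4 * c = (m + n) * ((m + n) * p + 1)"
  shows "is_MCR m n p A"
proof -
  have "2 * (c + d) = (m + n) * ((m + n) * p + 1)"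
    using first second by (intro constant_column_sum[OF bij \<open>0 < p\<close>]) (simp add: sum_lessThan_add)
  then have "d = c" using magic by simp
  then show ?thesis using bij first second unfolding is_MCR_def by blast
qed

section \<open>Sufficiency\<close>

text \<open>
  The number \<open>X\<close> is what remains of the magic column sum after the contribution
  \<open>(m div 2) * (p + 1)\<close> of the offsets in the first block. It is to be attained as \<open>p * T + r\<close>,
  where \<open>T\<close> is the sum of the indices of the intervals in the first block.
\<close>
lemma exists_first_block_target:
  fixes m n p :: nat
  assumes "even m" and "m \<le> n" and "(m + n) mod 4 = 0"
    and bound: "second_block_bound m n p"
  obtains X where "4 * (X + m div 2 * (p + 1)) = (m + n) * ((m + n) * p + 1)"
    and "p * \<Sum>{..<m} \<le> X" and "X \<le> p * (\<Sum>{..<m} + m * n)"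
proof -
  obtain a e where m_eq: "m = 2 * a" and total_eq: "m + n = 4 * e"
    using assms(1,3) by (auto elim!: evenE dvdE simp: mod_eq_0_iff_dvd)
  define b where "b = 2 * e - a"
  have n_eq: "n = 2 * b" and ab_eq: "a + b = 2 * e" and "a \<le> e"
    using m_eq total_eq \<open>m \<le> n\<close> by (auto simp: b_def)
  define c where "c = e * (4 * e * p + 1)"
  have c_double: "2 * c = p * (2 * a\<^sup>2 + 4 * a * b) + a + (2 * b\<^sup>2 * p + b)"
  proof -
    have "2 * c = (a + b) * (2 * (a + b) * p + 1)" by (simp add: c_def ab_eq)
    then show ?thesis by (simp add: algebra_simps power2_eq_square)
  qed
  have gauss: "\<Sum>{..<m} + a = 2 * a\<^sup>2"
    unfolding m_eq by (induction a) (auto simp: power2_eq_square lessThan_Suc algebra_simps)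
  then have row_sum: "p * \<Sum>{..<m} + a * (p + 1) = p * (2 * a\<^sup>2) + a"
    by (simp add: algebra_simps flip: gauss)
  also have "\<dots> \<le> p * (4 * e\<^sup>2) + e"
    using \<open>a \<le> e\<close> by (intro add_le_mono mult_le_mono power_mono) simp_all
  also have "\<dots> = c" by (simp add: c_def algebra_simps power2_eq_square)
  finally have lower: "p * \<Sum>{..<m} + a * (p + 1) \<le> c" .
  have "2 * b\<^sup>2 * p + b \<le> c"
    using bound unfolding second_block_bound_def total_eq
    by (simp add: n_eq c_def algebra_simps power2_eq_square)
  then have "c \<le> p * (2 * a\<^sup>2 + 4 * a * b) + a" using c_double by linarith
  also have "\<dots> = p * (\<Sum>{..<m} + m * n) + a * (p + 1)"
    using row_sum by (simp add: m_eq n_eq algebra_simps)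
  finally have upper: "c \<le> p * (\<Sum>{..<m} + m * n) + a * (p + 1)" .
  show thesis
  proof
    show "4 * (c - a * (p + 1) + m div 2 * (p + 1)) = (m + n) * ((m + n) * p + 1)"
      using lower unfolding total_eq by (simp add: m_eq c_def)
  qed (use lower upper in linarith)+
qed

lemma MCR_exists_if_bound:
  assumes "even m" and "even n" and "0 < m" and "m \<le> n" and "0 < p" and "(m + n) mod 4 = 0"
    and bound: "second_block_bound m n p"
  shows "MCR_exists m n p"
proof -
  obtain X where target: "4 * (X + m div 2 * (p + 1)) = (m + n) * ((m + n) * p + 1)"
    and lower: "p * \<Sum>{..<m} \<le> X" and upper: "X \<le> p * (\<Sum>{..<m} + m * n)"
    using exists_first_block_target[OF assms(1,4,6) bound] .
  define t where "t = X div p - \<Sum>{..<m}"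
  define r where "r = X mod p"
  have "\<Sum>{..<m} \<le> X div p"
    using div_le_mono[OF lower, of p] \<open>0 < p\<close> by simp
  then have X_eq: "X = p * (\<Sum>{..<m} + t) + r"
    by (simp add: t_def r_def)
  have "p * (\<Sum>{..<m} + t) \<le> p * (\<Sum>{..<m} + m * n)" using X_eq upper by linarith
  then have "t \<le> m * n" using \<open>0 < p\<close> by simp
  then obtain \<pi> h where bij: "bij_betw \<pi> {..<m + n} {..<m + n}"
    and sum: "(\<Sum>i<m. \<pi> i) = \<Sum>{..<m} + t"
    and "h < m" and adjacent: "t < m * n \<Longrightarrow> \<pi> m = Suc (\<pi> h)"
    using exists_interval_arrangement[of t m n] assms(3,4) by auto
  have "2 < n \<and> \<pi> m = Suc (\<pi> h)" if "0 < r"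
  proof
    show "2 < n"
    proof (rule ccontr)
      assume "\<not> 2 < n"
      then have "m = 2" "n = 2" using assms(1-4) by presburger+
      then have "X = 3 * p" using target by simp
      then show False using that by (simp add: r_def)
    qed
    have "t \<noteq> m * n" using X_eq upper that by auto
    then show "\<pi> m = Suc (\<pi> h)" using adjacent \<open>t \<le> m * n\<close> by simp
  qed
  then interpret shifted_interval_rows m n p r h \<pi>
    using assms bij \<open>h < m\<close> by unfold_locales (simp_all add: r_def)
  have "is_MCR m n p entry"
  proof (rule is_MCR_if_constant_blocks[OF bij_betw_entry \<open>0 < p\<close>])
    show "(\<Sum>i<m. entry i j) = X + m div 2 * (p + 1)" if "j < p" for j
      using sum_first_block[OF that] X_eq sum by simp
    show "(\<Sum>i\<in>{m..<m + n}. entry i j) = p * (\<Sum>i\<in>{m..<m + n}. \<pi> i) + n div 2 * (p + 1) - r"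
      if "j < p" for j
      using sum_second_block[OF that] by simp
  qed (rule target)
  then show ?thesis by (auto simp: MCR_exists_def)
qed

section \<open>The quadratic form of the bound\<close>

lemma sqrt_2_mult_le_iff:
  fixes x y :: int
  assumes "0 \<le> x" and "0 \<le> y"
  shows "sqrt 2 * y \<le> x \<longleftrightarrow> 2 * y\<^sup>2 \<le> x\<^sup>2"
proof -
  have "sqrt 2 * y \<le> x \<longleftrightarrow> (sqrt 2 * y)\<^sup>2 \<le> (real_of_int x)\<^sup>2"
    using abs_le_square_iff[of "sqrt 2 * y" "real_of_int x"] assms by (simp add: abs_mult)
  also have "(sqrt 2 * y)\<^sup>2 = real_of_int (2 * y\<^sup>2)" by (simp add: power_mult_distrib)
  finally show ?thesis by (simp only: of_int_le_iff flip: of_int_power)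
qed

lemma second_block_bound_iff:
  fixes m n p :: nat
  assumes "0 < p"
  shows "second_block_bound m n p \<longleftrightarrow>
    (1::int) = 2 * (2 * int p * int n + 1)^2 - (2 * int p * int m + 2 * int p * int n + 1)^2
     \<or> real m \<ge> (sqrt 2 - 1) * real n + (sqrt 2 - 1) / (2 * real p)"
proof -
  define X Y where "X = 2 * int p * int m + 2 * int p * int n + 1" and "Y = 2 * int p * int n + 1"
  have "(sqrt 2 - 1) * real n + (sqrt 2 - 1) / (2 * real p) \<le> real m \<longleftrightarrow>
      2 * real p * ((sqrt 2 - 1) * real n + (sqrt 2 - 1) / (2 * real p)) \<le> 2 * real p * real m"
    using assms by simp
  also have "2 * real p * ((sqrt 2 - 1) * real n + (sqrt 2 - 1) / (2 * real p)) = (sqrt 2 - 1) * Y"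
    using assms by (simp add: Y_def field_simps)
  also have "(\<dots> \<le> 2 * real p * real m) \<longleftrightarrow> sqrt 2 * Y \<le> X"
    by (simp add: X_def Y_def algebra_simps)
  also have "\<dots> \<longleftrightarrow> 2 * Y\<^sup>2 \<le> X\<^sup>2"
    by (intro sqrt_2_mult_le_iff) (simp_all add: X_def Y_def)
  finally have real_iff: "(sqrt 2 - 1) * real n + (sqrt 2 - 1) / (2 * real p) \<le> real m \<longleftrightarrow>
    2 * Y\<^sup>2 \<le> X\<^sup>2" .
  have "second_block_bound m n p \<longleftrightarrow>
      int (4 * p) * int (2 * n * (n * p + 1)) \<le> int (4 * p) * int ((m + n) * ((m + n) * p + 1))"
    using assms by (simp add: second_block_bound_def del: of_nat_mult of_nat_add)
  also have "\<dots> \<longleftrightarrow> 2 * Y\<^sup>2 - X\<^sup>2 \<le> 1"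
    by (simp add: X_def Y_def algebra_simps power2_eq_square)
  finally show ?thesis using real_iff unfolding X_def Y_def by linarith
qed

theorem theorem8:
  fixes m n p :: nat
  assumes "even m" and "even n" and "0 < m" and "m \<le> n" and "0 < p"
  shows "MCR_exists m n p \<longleftrightarrow>
           ((m + n) mod 4 = 0 \<and>
            ((1::int) = 2 * (2 * int p * int n + 1)^2 - (2 * int p * int m + 2 * int p * int n + 1)^2
             \<or> real m \<ge> (sqrt 2 - 1) * real n + (sqrt 2 - 1) / (2 * real p)))"
  unfolding second_block_bound_iff[OF \<open>0 < p\<close>, symmetric]
proof
  assume "MCR_exists m n p"
  then obtain A where "is_MCR m n p A" unfolding MCR_exists_def ..
  then show "(m + n) mod 4 = 0 \<and> second_block_bound m n p"
    using is_MCR_mod_4_eq_0 is_MCR_second_block_bound assms by simp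
next
  assume "(m + n) mod 4 = 0 \<and> second_block_bound m n p"
  then show "MCR_exists m n p" using MCR_exists_if_bound[of m n p] assms by simp
qed

end
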